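(* Let $D > E \geq 1$ be integers and let $f:\mathbb{R}^D \to \mathbb{R}^E$ be a continuous function. Then $f$ admits no inverse on any nonempty open region of its domain: there is no nonempty open set $U \subseteq \mathbb{R}^D$ such that the restriction $f|_U : U \to f(U)$ is bijective (equivalently, such that there exists a function $g : f(U) \to U$ with $g(f(\mathbf{x})) = \mathbf{x}$ for all $\mathbf{x} \in U$ and $f(g(\mathbf{z})) = \mathbf{z}$ for all $\mathbf{z} \in f(U)$).
   Context: $\mathbb{R}^D$ and $\mathbb{R}^E$ carry their usual Euclidean topologies. An inverse of a function $f: X \to Y$ is a function $f^{-1}: Y \to X$ such that $f^{-1}(f(x)) = x$ for all $x \in X$ and $f(f^{-1}(y)) = y$ for all $y \in Y$. *)

theory Defs
  imports "HOL-Analysis.Analysis"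
begin

text \<open>
  Functions in HOL are total, so a map from X to Y is a total function that sends X into Y;
  values outside the carrier sets are irrelevant.
\<close>

definition is_inverse_on :: "('a \<Rightarrow> 'b) \<Rightarrow> 'a set \<Rightarrow> 'b set \<Rightarrow> ('b \<Rightarrow> 'a) \<Rightarrow> bool" where
  "is_inverse_on f X Y g \<longleftrightarrow>
     f \<in> X \<rightarrow> Y \<and> g \<in> Y \<rightarrow> X \<and> (\<forall>x\<in>X. g (f x) = x) \<and> (\<forall>y\<in>Y. f (g y) = y)"

end

theory Submission imports Defs
begin

text \<open>Both a bijection onto the image and an inverse force \<open>f\<close> to be injective on
  \<open>U\<close>. By \<open>invariance_of_dimension\<close>, a consequence of Brouwer's invariance
  of domain, a continuous injection on a nonempty open set cannot lower the dimension.\<close>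

theorem corollary9p1:
  fixes f :: "real ^ 'D::finite \<Rightarrow> real ^ 'E::finite"
  assumes "CARD('D) > CARD('E)"
    and "CARD('E) \<ge> 1"
    and "continuous_on UNIV f"
  shows "(\<nexists>U. open U \<and> U \<noteq> {} \<and> bij_betw f U (f ` U)) \<and>
         (\<nexists>U. open U \<and> U \<noteq> {} \<and> (\<exists>g. is_inverse_on f U (f ` U) g))"
proof -
  have not_inj: "\<not> inj_on f U" if "open U" "U \<noteq> {}" for U
  proof
    assume "inj_on f U"
    moreover have "continuous_on U f"
      using assms(3) by (rule continuous_on_subset) simp
    ultimately have "DIM(real ^ 'D) \<le> DIM(real ^ 'E)"
      using that invariance_of_dimension by blast
    with assms(1) show False
      by simp
  qed
  \<comment> \<open>Only the left-inverse law \<open>g (f x) = x\<close> matters here: it already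
    gives injectivity.\<close>
  then have "\<not> is_inverse_on f U (f ` U) g" if "open U" "U \<noteq> {}" for U g
    using that unfolding is_inverse_on_def by (metis inj_on_inverseI)
  with not_inj show ?thesis
    by (meson bij_betw_imp_inj_on)
qed

end
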